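(* Assume that $\beta\mapsto F(\beta,S(u),u)$ is strongly convex with a constant $\mu_\beta>0$ independent of the control $u$. Let a non-degenerate simplex $T\subset Q$ be given, and assume that there exists $\beta\in T$ with $\varphi(\beta)<\xi_T(\beta)$. For $\gamma\ge 0$ denote by $(\beta_\gamma,y_\gamma,u_\gamma)$ a solution of $(\mathrm{OVRP}(T,\gamma))$. Let the penalty parameter $\gamma_T$ be chosen such that one of the following cases holds: (a) $\gamma_T=0$ and $f(\tilde\beta,\tilde y,\tilde u)\le\xi_T(\tilde\beta)$ for one global solution $(\tilde\beta,\tilde y,\tilde u)$ of $(\mathrm{OVRP}(T,0))$; (b) $\gamma_T>0$ and $f(\beta_{\gamma_T},y_{\gamma_T},u_{\gamma_T})=\xi_T(\beta_{\gamma_T})$. Then the point $(\tilde\beta,\tilde y,\tilde u)$ in case (a), respectively $(\beta_{\gamma_T},y_{\gamma_T},u_{\gamma_T})$ in case (b), is a solution of $(\mathrm{OVR}(\xi,T))$, and $\gamma_T$ is a multiplier corresponding to the constraint $f(\beta,y,u)\le\xi_T(\beta)$ in the optimality (KKT) system of $(\mathrm{OVR}(\xi,T))$ at this point.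
   Context: **Standing setting.** $Y,U$ are real Hilbert spaces with duals $Y^*,U^*$. $Q\subset\mathbb R^n$ is a nonempty bounded polyhedron (intersection of finitely many closed halfspaces) with nonempty interior. $U_{ad}\subset U$ is nonempty, closed, convex. $A\in L[Y,Y^*]$ is an isomorphism, $B\in L[U,Y^*]$ is bounded linear, $S:=A^{-1}B\in L[U,Y]$. The functionals $F,f:Q\times Y\times U\to\mathbb R$ are bounded from below, convex and continuously Fréchet differentiable. For every $M\ge 0$ there is $L_M\ge 0$ such that $\|f'_\beta(\beta_1,y_1,u_1)-f'_\beta(\beta_2,y_2,u_2)\|\le L_M(\|\beta_1-\beta_2\|+\|y_1-y_2\|_Y+\|u_1-u_2\|_U)$, $|F(\beta,y_1,u_1)-F(\beta,y_2,u_2)|\le L_M(\|y_1-y_2\|_Y+\|u_1-u_2\|_U)$, $\|f'_u(\beta_1,S(u),u)-f'_u(\beta_2,S(u),u)\|_{U^*}\le L_M\|\beta_1-\beta_2\|$, $\|f'_y(\beta_1,S(u),u)-f'_y(\beta_2,S(u),u)\|_{Y^*}\le L_M\|\beta_1-\beta_2\|$ for all $\beta,\beta_1,\beta_2\in Q$, all $y_1,y_2\in Y$ of norm $\le M$ and all $u,u_1,u_2\in U_{ad}$ of norm $\le M$. There is $\mu>0$ such that for all $\beta\in Q$, $u_1,u_2\in U_{ad}$: $f(\beta,S(u_2),u_2)\ge f(\beta,S(u_1),u_1)+\langle f'_y(\cdot),S(u_2-u_1)\rangle+\langle f'_u(\cdot),u_2-u_1\rangle+\frac\mu2\|u_2-u_1\|_U^2$,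 with derivatives taken at $(\beta,S(u_1),u_1)$. **Problems.** $\varphi(\beta):=\inf\{f(\beta,y,u):(y,u)\in Y\times U_{ad},\ Ay=Bu\}$ for $\beta\in Q$; $\xi_T:T\to\mathbb R$ is the affine function interpolating $\varphi$ at the vertices of $T$. $(\mathrm{OVR}(\xi,T))$: minimize $F(\beta,y,u)$ subject to $\beta\in T$, $f(\beta,y,u)-\xi_T(\beta)\le0$, $Ay-Bu=0$, $u\in U_{ad}$. $(\mathrm{OVRP}(T,\gamma))$ (with penalty function the identity): minimize $F(\beta,y,u)+\gamma\,(f(\beta,y,u)-\xi_T(\beta))$ subject to $\beta\in T$, $Ay-Bu=0$, $u\in U_{ad}$. **Multiplier.** $\lambda\in\mathbb R$ is a multiplier corresponding to $f(\beta,y,u)\le\xi_T(\beta)$ at a feasible point $(\beta,y,u)$ of $(\mathrm{OVR}(\xi,T))$ if $\lambda\ge0$, $\lambda(f(\beta,y,u)-\xi_T(\beta))=0$, and there exist $p\in Y$, $\zeta\in\mathcal N_T(\beta)$, $\nu\in\mathcal N_{U_{ad}}(u)$ (normal cones of convex analysis) with $F'_\beta+\lambda(f'_\beta-\xi_T')+\zeta=0$, $F'_y+\lambda f'_y+A^*p=0$, $F'_u+\lambda f'_u-B^*p+\nu=0$, all derivatives of $F,f$ taken at $(\beta,y,u)$. *)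

theory Defs
  imports "HOL-Analysis.Analysis"
begin

section \<open>Notions of convex and differential calculus\<close>

text \<open>
  The topological dual of \<open>'a\<close> is the type \<open>'a \<Rightarrow>\<^sub>L real\<close> with the operator norm.

  The derivative below is the unique Frechet derivative whenever \<open>g\<close> is differentiable at \<open>x\<close>
  within \<open>S\<close>, \<open>x \<in> S\<close>, and \<open>S\<close> is convex with nonempty interior. Only such \<open>S\<close> are used.
\<close>

definition fderiv ::
  "('a::real_normed_vector \<Rightarrow> real) \<Rightarrow> 'a set \<Rightarrow> 'a \<Rightarrow> ('a \<Rightarrow>\<^sub>L real)" where
  "fderiv g S x = (THE D. (g has_derivative blinfun_apply D) (at x within S))"

definition continuously_differentiable_on ::
  "('a::real_normed_vector \<Rightarrow> real) \<Rightarrow> 'a set \<Rightarrow> bool" where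
  "continuously_differentiable_on g S \<longleftrightarrow>
     g differentiable_on S \<and> continuous_on S (fderiv g S)"

definition strongly_convex_on ::
  "'a::real_inner set \<Rightarrow> real \<Rightarrow> ('a \<Rightarrow> real) \<Rightarrow> bool" where
  "strongly_convex_on C \<mu> g \<longleftrightarrow>
     convex C \<and>
     (\<forall>x\<in>C. \<forall>y\<in>C. \<forall>t\<in>{0..1}.
        g ((1 - t) *\<^sub>R x + t *\<^sub>R y)
          \<le> (1 - t) * g x + t * g y - \<mu> / 2 * t * (1 - t) * (norm (x - y))\<^sup>2)"

definition normal_cone ::
  "'a::real_normed_vector set \<Rightarrow> 'a \<Rightarrow> ('a \<Rightarrow>\<^sub>L real) set" where
  "normal_cone C x = {\<zeta>. x \<in> C \<and> (\<forall>z\<in>C. blinfun_apply \<zeta> (z - x) \<le> 0)}"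

text \<open>
  For \<open>K \<in> L[X, Y\<^sup>*]\<close> with \<open>Y\<close> reflexive, the adjoint is regarded as a map \<open>Y \<rightarrow> X\<^sup>*\<close>:
  \<open>\<langle>K\<^sup>* p, h\<rangle> = \<langle>K h, p\<rangle>\<close>.
\<close>

definition dual_adjoint ::
  "('x::real_normed_vector \<Rightarrow>\<^sub>L ('y::real_normed_vector \<Rightarrow>\<^sub>L real)) \<Rightarrow> 'y \<Rightarrow> ('x \<Rightarrow>\<^sub>L real)" where
  "dual_adjoint K p = blinfun.prod_left p o\<^sub>L K"

section \<open>Partial derivatives of functionals on \<open>Q \<times> Y \<times> U\<close>\<close>

definition deriv_beta ::
  "'b::real_normed_vector set \<Rightarrow> ('b \<times> 'y \<times> 'u \<Rightarrow> real) \<Rightarrow> 'b \<Rightarrow> 'y \<Rightarrow> 'u \<Rightarrow> ('b \<Rightarrow>\<^sub>L real)" where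
  "deriv_beta Q g \<beta> y u = fderiv (\<lambda>b. g (b, y, u)) Q \<beta>"

definition deriv_y ::
  "('b \<times> 'y::real_normed_vector \<times> 'u \<Rightarrow> real) \<Rightarrow> 'b \<Rightarrow> 'y \<Rightarrow> 'u \<Rightarrow> ('y \<Rightarrow>\<^sub>L real)" where
  "deriv_y g \<beta> y u = fderiv (\<lambda>z. g (\<beta>, z, u)) UNIV y"

definition deriv_u ::
  "('b \<times> 'y \<times> 'u::real_normed_vector \<Rightarrow> real) \<Rightarrow> 'b \<Rightarrow> 'y \<Rightarrow> 'u \<Rightarrow> ('u \<Rightarrow>\<^sub>L real)" where
  "deriv_u g \<beta> y u = fderiv (\<lambda>v. g (\<beta>, y, v)) UNIV u"

section \<open>Standing assumptions\<close>

definition solution_op ::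
  "('y::real_normed_vector \<Rightarrow>\<^sub>L ('y \<Rightarrow>\<^sub>L real)) \<Rightarrow> ('u::real_normed_vector \<Rightarrow>\<^sub>L ('y \<Rightarrow>\<^sub>L real)) \<Rightarrow> 'u \<Rightarrow> 'y" where
  "solution_op A B u = inv (blinfun_apply A) (blinfun_apply B u)"

locale inverse_control_setting =
  fixes Q :: "(real ^ 'n) set"
    and Uad :: "'u::{real_inner, complete_space} set"
    and A :: "'y::{real_inner, complete_space} \<Rightarrow>\<^sub>L ('y \<Rightarrow>\<^sub>L real)"
    and B :: "'u \<Rightarrow>\<^sub>L ('y \<Rightarrow>\<^sub>L real)"
    and F f :: "(real ^ 'n) \<times> 'y \<times> 'u \<Rightarrow> real"
  assumes Q: "polyhedron Q" "bounded Q" "interior Q \<noteq> {}"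
    and Uad: "Uad \<noteq> {}" "closed Uad" "convex Uad"
    and A_iso: "bij (blinfun_apply A)" "bounded_linear (inv (blinfun_apply A))"
    and F: "bdd_below (F ` (Q \<times> UNIV \<times> UNIV))" "convex_on (Q \<times> UNIV \<times> UNIV) F"
      "continuously_differentiable_on F (Q \<times> UNIV \<times> UNIV)"
    and f: "bdd_below (f ` (Q \<times> UNIV \<times> UNIV))" "convex_on (Q \<times> UNIV \<times> UNIV) f"
      "continuously_differentiable_on f (Q \<times> UNIV \<times> UNIV)"
    and Lipschitz:
      "\<forall>M\<ge>0. \<exists>L\<ge>0.
         \<forall>\<beta>\<in>Q. \<forall>\<beta>\<^sub>1\<in>Q. \<forall>\<beta>\<^sub>2\<in>Q. \<forall>y\<^sub>1\<in>cball 0 M. \<forall>y\<^sub>2\<in>cball 0 M.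
         \<forall>u\<in>Uad \<inter> cball 0 M. \<forall>u\<^sub>1\<in>Uad \<inter> cball 0 M. \<forall>u\<^sub>2\<in>Uad \<inter> cball 0 M.
           norm (deriv_beta Q f \<beta>\<^sub>1 y\<^sub>1 u\<^sub>1 - deriv_beta Q f \<beta>\<^sub>2 y\<^sub>2 u\<^sub>2)
             \<le> L * (norm (\<beta>\<^sub>1 - \<beta>\<^sub>2) + norm (y\<^sub>1 - y\<^sub>2) + norm (u\<^sub>1 - u\<^sub>2)) \<and>
           \<bar>F (\<beta>, y\<^sub>1, u\<^sub>1) - F (\<beta>, y\<^sub>2, u\<^sub>2)\<bar> \<le> L * (norm (y\<^sub>1 - y\<^sub>2) + norm (u\<^sub>1 - u\<^sub>2)) \<and>
           norm (deriv_u f \<beta>\<^sub>1 (solution_op A B u) u - deriv_u f \<beta>\<^sub>2 (solution_op A B u) u)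
             \<le> L * norm (\<beta>\<^sub>1 - \<beta>\<^sub>2) \<and>
           norm (deriv_y f \<beta>\<^sub>1 (solution_op A B u) u - deriv_y f \<beta>\<^sub>2 (solution_op A B u) u)
             \<le> L * norm (\<beta>\<^sub>1 - \<beta>\<^sub>2)"
    and strong_convexity_in_control:
      "\<exists>\<mu>>0. \<forall>\<beta>\<in>Q. \<forall>u\<^sub>1\<in>Uad. \<forall>u\<^sub>2\<in>Uad.
         f (\<beta>, solution_op A B u\<^sub>2, u\<^sub>2)
           \<ge> f (\<beta>, solution_op A B u\<^sub>1, u\<^sub>1)
             + blinfun_apply (deriv_y f \<beta> (solution_op A B u\<^sub>1) u\<^sub>1) (solution_op A B (u\<^sub>2 - u\<^sub>1))
             + blinfun_apply (deriv_u f \<beta> (solution_op A B u\<^sub>1) u\<^sub>1) (u\<^sub>2 - u\<^sub>1)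
             + \<mu> / 2 * (norm (u\<^sub>2 - u\<^sub>1))\<^sup>2"

section \<open>Value function, interpolation and optimization problems\<close>

definition value_fun ::
  "'u set \<Rightarrow> ('y::real_normed_vector \<Rightarrow>\<^sub>L ('y \<Rightarrow>\<^sub>L real)) \<Rightarrow> ('u::real_normed_vector \<Rightarrow>\<^sub>L ('y \<Rightarrow>\<^sub>L real)) \<Rightarrow>
   ('b \<times> 'y \<times> 'u \<Rightarrow> real) \<Rightarrow> 'b \<Rightarrow> real" where
  "value_fun Uad A B f \<beta> =
     Inf {f (\<beta>, y, u) | y u. u \<in> Uad \<and> blinfun_apply A y = blinfun_apply B u}"

text \<open>
  For a full-dimensional simplex \<open>T\<close>, whose vertices are its extreme points, there is exactly one
  affine function interpolating \<open>\<phi>\<close> at the vertices. It is given with its canonical affine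
  extension to the whole space, so that its derivative can be taken within \<open>UNIV\<close>.
\<close>

definition affine_interpolant ::
  "('b::real_inner \<Rightarrow> real) \<Rightarrow> 'b set \<Rightarrow> 'b \<Rightarrow> real" where
  "affine_interpolant \<phi> T =
     (THE g. (\<exists>a c. \<forall>x. g x = a \<bullet> x + c) \<and> (\<forall>v. v extreme_point_of T \<longrightarrow> g v = \<phi> v))"

definition OVR_feasible ::
  "'u set \<Rightarrow> ('y::real_normed_vector \<Rightarrow>\<^sub>L ('y \<Rightarrow>\<^sub>L real)) \<Rightarrow> ('u::real_normed_vector \<Rightarrow>\<^sub>L ('y \<Rightarrow>\<^sub>L real)) \<Rightarrow>
   ('b \<times> 'y \<times> 'u \<Rightarrow> real) \<Rightarrow> ('b \<Rightarrow> real) \<Rightarrow> 'b set \<Rightarrow> 'b \<times> 'y \<times> 'u \<Rightarrow> bool" where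
  "OVR_feasible Uad A B f \<xi> T = (\<lambda>(\<beta>, y, u).
     \<beta> \<in> T \<and> f (\<beta>, y, u) - \<xi> \<beta> \<le> 0 \<and> blinfun_apply A y - blinfun_apply B u = 0 \<and> u \<in> Uad)"

definition OVR_solution ::
  "'u set \<Rightarrow> ('y::real_normed_vector \<Rightarrow>\<^sub>L ('y \<Rightarrow>\<^sub>L real)) \<Rightarrow> ('u::real_normed_vector \<Rightarrow>\<^sub>L ('y \<Rightarrow>\<^sub>L real)) \<Rightarrow>
   ('b \<times> 'y \<times> 'u \<Rightarrow> real) \<Rightarrow> ('b \<times> 'y \<times> 'u \<Rightarrow> real) \<Rightarrow> ('b \<Rightarrow> real) \<Rightarrow> 'b set \<Rightarrow>
   'b \<times> 'y \<times> 'u \<Rightarrow> bool" where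
  "OVR_solution Uad A B F f \<xi> T = is_arg_min F (OVR_feasible Uad A B f \<xi> T)"

definition OVRP_solution ::
  "'u set \<Rightarrow> ('y::real_normed_vector \<Rightarrow>\<^sub>L ('y \<Rightarrow>\<^sub>L real)) \<Rightarrow> ('u::real_normed_vector \<Rightarrow>\<^sub>L ('y \<Rightarrow>\<^sub>L real)) \<Rightarrow>
   ('b \<times> 'y \<times> 'u \<Rightarrow> real) \<Rightarrow> ('b \<times> 'y \<times> 'u \<Rightarrow> real) \<Rightarrow> ('b \<Rightarrow> real) \<Rightarrow> 'b set \<Rightarrow> real \<Rightarrow>
   'b \<times> 'y \<times> 'u \<Rightarrow> bool" where
  "OVRP_solution Uad A B F f \<xi> T \<gamma> =
     is_arg_min (\<lambda>(\<beta>, y, u). F (\<beta>, y, u) + \<gamma> * (f (\<beta>, y, u) - \<xi> \<beta>))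
       (\<lambda>(\<beta>, y, u). \<beta> \<in> T \<and> blinfun_apply A y - blinfun_apply B u = 0 \<and> u \<in> Uad)"

definition OVR_multiplier ::
  "'b::real_normed_vector set \<Rightarrow> 'u set \<Rightarrow> ('y::real_normed_vector \<Rightarrow>\<^sub>L ('y \<Rightarrow>\<^sub>L real)) \<Rightarrow>
   ('u::real_normed_vector \<Rightarrow>\<^sub>L ('y \<Rightarrow>\<^sub>L real)) \<Rightarrow>
   ('b \<times> 'y \<times> 'u \<Rightarrow> real) \<Rightarrow> ('b \<times> 'y \<times> 'u \<Rightarrow> real) \<Rightarrow> ('b \<Rightarrow> real) \<Rightarrow> 'b set \<Rightarrow>
   'b \<times> 'y \<times> 'u \<Rightarrow> real \<Rightarrow> bool" where
  "OVR_multiplier Q Uad A B F f \<xi> T = (\<lambda>(\<beta>, y, u) \<kappa>.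
     OVR_feasible Uad A B f \<xi> T (\<beta>, y, u) \<and>
     \<kappa> \<ge> 0 \<and> \<kappa> * (f (\<beta>, y, u) - \<xi> \<beta>) = 0 \<and>
     (\<exists>p. \<exists>\<zeta>\<in>normal_cone T \<beta>. \<exists>\<nu>\<in>normal_cone Uad u.
        deriv_beta Q F \<beta> y u + \<kappa> *\<^sub>R (deriv_beta Q f \<beta> y u - fderiv \<xi> UNIV \<beta>) + \<zeta> = 0 \<and>
        deriv_y F \<beta> y u + \<kappa> *\<^sub>R deriv_y f \<beta> y u + dual_adjoint A p = 0 \<and>
        deriv_u F \<beta> y u + \<kappa> *\<^sub>R deriv_u f \<beta> y u - dual_adjoint B p + \<nu> = 0))"

end

theory Submission
  imports Defs
begin

text \<open>
  Write \<open>J = F + \<gamma> (f - \<xi>)\<close> for the penalized objective. In both cases the term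
  \<open>\<gamma> (f - \<xi>)\<close> vanishes at the given point, whereas it is nonpositive at every feasible point
  of the original problem, whose feasible set is contained in that of the penalized one. Hence
  minimality of \<open>J\<close> at the point implies minimality of \<open>F\<close> over the feasible points.

  The penalized problem has the convex feasible set
  \<open>{(\<beta>, y, u). \<beta> \<in> T, A y = B u, u \<in> Uad}\<close>, and so its first-order condition is the variational
  inequality \<open>J' (z - x) \<ge> 0\<close> for feasible \<open>z\<close>. Split \<open>J'\<close> into partial derivatives.
  Varying \<open>\<beta>\<close> alone gives the inclusion in the normal cone of \<open>T\<close>. The adjoint state \<open>p\<close> is
  the solution of \<open>A\<^sup>* p = - J'\<^sub>y\<close>; it exists because \<open>A\<close> is an isomorphism and \<open>Y\<close>, being a
  Hilbert space, is reflexive. Varying \<open>u\<close> together with the state that it determines, and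
  eliminating the state through \<open>p\<close>, gives the inclusion in the normal cone of \<open>Uad\<close>. These
  relations are the optimality system of the original problem with \<open>\<gamma>\<close> as the multiplier, and
  complementarity is the vanishing of \<open>\<gamma> (f - \<xi>)\<close> at the point.

  Two preparations make the derivatives meaningful. On a convex set with nonempty interior a
  Frechet derivative is unique even at boundary points, since it is determined by the difference
  quotients along the segments inside the set. And the interpolant on a full-dimensional simplex
  exists, is unique and is an affine function of the form \<open>x \<mapsto> a \<bullet> x + c\<close>.
\<close>

section \<open>Derivatives on convex sets\<close>

lemma difference_quotient_along_segment:
  fixes g :: "'a::real_normed_vector \<Rightarrow> real"
  assumes g: "(g has_derivative D) (at x within S)"
    and S: "convex S" "x \<in> S" "z \<in> S"
  shows "((\<lambda>t. (g (x + t *\<^sub>R (z - x)) - g x) / t) \<longlongrightarrow> D (z - x)) (at_right 0)"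
proof -
  let ?c = "\<lambda>t::real. x + t *\<^sub>R (z - x)"
  have img: "?c ` {0..1} \<subseteq> S"
  proof clarify
    fix t :: real assume "t \<in> {0..1}"
    then have "(1 - t) *\<^sub>R x + t *\<^sub>R z \<in> S"
      using S by (intro convexD) auto
    then show "?c t \<in> S" by (simp add: algebra_simps)
  qed
  have "(?c has_derivative (\<lambda>t. t *\<^sub>R (z - x))) (at 0 within {0..1})"
    by (auto intro!: derivative_eq_intros)
  moreover have "(g has_derivative D) (at (?c 0) within ?c ` {0..1})"
    using has_derivative_subset[OF g img] by simp
  ultimately have "((\<lambda>t. g (?c t)) has_derivative (\<lambda>t. D (t *\<^sub>R (z - x)))) (at 0 within {0..1})"
    by (rule has_derivative_in_compose)
  moreover have "(\<lambda>t. D (t *\<^sub>R (z - x))) = (*) (D (z - x))"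
    using linear_scale[OF has_derivative_linear[OF g]] by (auto simp: mult.commute)
  ultimately have "((\<lambda>t. g (?c t)) has_real_derivative D (z - x)) (at 0 within {0..1})"
    by (simp add: has_field_derivative_def)
  then show ?thesis
    by (simp add: has_field_derivative_iff at_within_Icc_at_right)
qed

text \<open>
  Both derivatives are the limit of the same difference quotients in the directions \<open>z - x\<close> with
  \<open>z \<in> S\<close>. Since \<open>S\<close> contains a ball, differences of such directions fill a ball around the
  origin, and linearity does the rest.
\<close>

lemma has_derivative_unique_on_convex:
  fixes g :: "'a::real_normed_vector \<Rightarrow> real"
  assumes D: "(g has_derivative D) (at x within S)" and D': "(g has_derivative D') (at x within S)"
    and S: "convex S" "interior S \<noteq> {}" "x \<in> S"
  shows "D = D'"
proof
  fix h :: 'a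
  interpret D: bounded_linear D using has_derivative_bounded_linear[OF D] .
  interpret D': bounded_linear D' using has_derivative_bounded_linear[OF D'] .
  have eq: "D (z - x) = D' (z - x)" if "z \<in> S" for z
    using difference_quotient_along_segment[OF D S(1,3) that]
      difference_quotient_along_segment[OF D' S(1,3) that]
    by (intro tendsto_unique) auto
  obtain w e where e: "e > 0" "cball w e \<subseteq> S"
    using S(2) by (meson all_not_in_conv mem_interior_cball)
  \<comment> \<open>the summand 1 keeps the denominator positive for \<open>h = 0\<close>\<close>
  define t where "t = e / (norm h + 1)"
  have "norm h + 1 > 0" using norm_ge_zero[of h] by linarith
  then have t: "t > 0" "t * norm h \<le> e"
    using e(1) by (auto simp: t_def field_simps)
  then have "w + t *\<^sub>R h \<in> S" "w \<in> S"
    using e by (auto simp: dist_norm intro!: subsetD[OF e(2)])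
  then have "D (w + t *\<^sub>R h - x) - D (w - x) = D' (w + t *\<^sub>R h - x) - D' (w - x)"
    using eq by simp
  then have "t * D h = t * D' h"
    by (simp add: D.add D.diff D.scaleR D'.add D'.diff D'.scaleR)
  then show "D h = D' h" using t by simp
qed

lemma fderiv_apply:
  assumes D: "(g has_derivative D) (at x within S)"
    and S: "convex S" "interior S \<noteq> {}" "x \<in> S"
  shows "blinfun_apply (fderiv g S x) = D"
proof -
  have lin: "bounded_linear D" using has_derivative_bounded_linear[OF D] .
  have "fderiv g S x = Blinfun D"
    unfolding fderiv_def
  proof (rule the_equality)
    show "(g has_derivative blinfun_apply (Blinfun D)) (at x within S)"
      using D lin by (simp add: bounded_linear_Blinfun_apply)
    fix E assume "(g has_derivative blinfun_apply E) (at x within S)"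
    then have "blinfun_apply E = D"
      using has_derivative_unique_on_convex D S by blast
    then show "E = Blinfun D"
      by (metis blinfun_apply_inverse)
  qed
  then show ?thesis using lin by (simp add: bounded_linear_Blinfun_apply)
qed

text \<open>
  Freezing two of the variables composes \<open>g\<close> with an affine map into \<open>Q \<times> UNIV \<times> UNIV\<close>, so the
  partial derivatives are the restrictions of the total one to the coordinate directions.
\<close>

lemma has_derivative_sum_of_partials:
  fixes g :: "(real ^ 'n) \<times> 'y::real_normed_vector \<times> 'u::real_normed_vector \<Rightarrow> real"
  assumes g: "g differentiable_on (Q \<times> UNIV \<times> UNIV)"
    and Q: "convex Q" "interior Q \<noteq> {}" "\<beta> \<in> Q"
  shows "(g has_derivative (\<lambda>(h, k, l). blinfun_apply (deriv_beta Q g \<beta> y u) h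
      + blinfun_apply (deriv_y g \<beta> y u) k + blinfun_apply (deriv_u g \<beta> y u) l))
    (at (\<beta>, y, u) within Q \<times> UNIV \<times> UNIV)"
proof -
  obtain D where D: "(g has_derivative D) (at (\<beta>, y, u) within Q \<times> UNIV \<times> UNIV)"
    using g Q(3) by (force simp: differentiable_on_def differentiable_def)
  interpret D: bounded_linear D using has_derivative_bounded_linear[OF D] .
  have beta: "blinfun_apply (deriv_beta Q g \<beta> y u) = (\<lambda>h. D (h, 0, 0))"
    unfolding deriv_beta_def
  proof (rule fderiv_apply[OF _ Q])
    show "((\<lambda>b. g (b, y, u)) has_derivative (\<lambda>h. D (h, 0, 0))) (at \<beta> within Q)"
      by (rule has_derivative_in_compose[where f = "\<lambda>b. (b, y, u)" and g = g])
        (auto simp: zero_prod_def intro!: derivative_eq_intros has_derivative_subset[OF D])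
  qed
  have y: "blinfun_apply (deriv_y g \<beta> y u) = (\<lambda>k. D (0, k, 0))"
    unfolding deriv_y_def
  proof (rule fderiv_apply)
    show "((\<lambda>z. g (\<beta>, z, u)) has_derivative (\<lambda>k. D (0, k, 0))) (at y)"
      by (rule has_derivative_in_compose[where f = "\<lambda>z. (\<beta>, z, u)" and g = g])
        (use Q in \<open>auto simp: zero_prod_def intro!: derivative_eq_intros has_derivative_subset[OF D]\<close>)
  qed auto
  have u: "blinfun_apply (deriv_u g \<beta> y u) = (\<lambda>l. D (0, 0, l))"
    unfolding deriv_u_def
  proof (rule fderiv_apply)
    show "((\<lambda>v. g (\<beta>, y, v)) has_derivative (\<lambda>l. D (0, 0, l))) (at u)"
      by (rule has_derivative_in_compose[where f = "\<lambda>v. (\<beta>, y, v)" and g = g])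
        (use Q in \<open>auto simp: zero_prod_def intro!: derivative_eq_intros has_derivative_subset[OF D]\<close>)
  qed auto
  have "D (h, 0, 0) + D (0, k, 0) + D (0, 0, l) = D (h, k, l)" for h k l
    by (simp add: D.add[symmetric])
  then have split: "(\<lambda>(h, k, l). D (h, 0, 0) + D (0, k, 0) + D (0, 0, l)) = D"
    by (simp add: fun_eq_iff)
  show ?thesis
    unfolding beta y u split by (rule D)
qed

lemma minimizer_variational_inequality:
  fixes J :: "'a::real_normed_vector \<Rightarrow> real"
  assumes J: "(J has_derivative D) (at x within C)"
    and C: "convex C" "x \<in> C" "z \<in> C"
    and min: "\<And>w. w \<in> C \<Longrightarrow> J x \<le> J w"
  shows "D (z - x) \<ge> 0"
proof (rule tendsto_lowerbound)
  show "((\<lambda>t. (J (x + t *\<^sub>R (z - x)) - J x) / t) \<longlongrightarrow> D (z - x)) (at_right 0)"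
    by (rule difference_quotient_along_segment[OF J C])
  have "(J (x + t *\<^sub>R (z - x)) - J x) / t \<ge> 0" if "0 < t" "t < 1" for t
  proof -
    have "(1 - t) *\<^sub>R x + t *\<^sub>R z \<in> C"
      using C that by (intro convexD) auto
    then have "J x \<le> J (x + t *\<^sub>R (z - x))"
      by (intro min) (simp add: algebra_simps)
    then show ?thesis using that by simp
  qed
  then show "\<forall>\<^sub>F t in at_right 0. (J (x + t *\<^sub>R (z - x)) - J x) / t \<ge> 0"
    by (intro eventually_mono[OF eventually_at_right_real[of 0 "1::real"]]) auto
qed simp

section \<open>Reflexivity of Hilbert spaces and the adjoint equation\<close>

text \<open>
  The representing vector is the minimizer of the energy \<open>x \<bullet> x - 2 \<phi> x\<close>. By the parallelogram
  law the sublevel sets of the energy near its infimum have small diameter, so completeness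
  provides the minimizer; the representation is the Euler equation there.
\<close>

lemma riesz_representation:
  fixes \<phi> :: "'a::{real_inner, complete_space} \<Rightarrow>\<^sub>L real"
  obtains a where "\<And>x. blinfun_apply \<phi> x = a \<bullet> x"
proof -
  define g where "g x = x \<bullet> x - 2 * blinfun_apply \<phi> x" for x
  have lower: "g x \<ge> - (norm \<phi>)\<^sup>2" for x
  proof -
    have "blinfun_apply \<phi> x \<le> norm \<phi> * norm x"
      using norm_blinfun[of \<phi> x] by simp
    moreover have "2 * (norm \<phi> * norm x) \<le> x \<bullet> x + (norm \<phi>)\<^sup>2"
      using sum_squares_bound[of "norm \<phi>" "norm x"] by (simp add: power2_norm_eq_inner)
    ultimately show ?thesis unfolding g_def by linarith
  qed
  then have bdd: "bdd_below (range g)" by (meson bdd_belowI2)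
  define m where "m = Inf (range g)"
  have m: "m \<le> g x" for x
    unfolding m_def using bdd by (intro cInf_lower) auto
  define S where "S n = {x. g x \<le> m + 1 / real (Suc n)}" for n
  have cont: "continuous_on UNIV g"
    unfolding g_def by (intro continuous_intros)
  obtain a where a: "\<And>n. a \<in> S n"
  proof (rule decreasing_closed_nest[of S])
    show "closed (S n)" for n
      unfolding S_def using cont by (intro closed_Collect_le) auto
    show "S n \<noteq> {}" for n
    proof -
      have "\<exists>x\<in>range g. x < m + 1 / real (Suc n)"
        unfolding m_def by (intro cInf_lessD) auto
      then show ?thesis by (auto simp: S_def intro: less_imp_le)
    qed
    show "S n \<subseteq> S k" if "k \<le> n" for k n
    proof -
      have "1 / real (Suc n) \<le> 1 / real (Suc k)" using that by (simp add: field_simps)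
      then show ?thesis by (auto simp: S_def)
    qed
    show "\<exists>n. \<forall>x\<in>S n. \<forall>y\<in>S n. dist x y < e" if "e > 0" for e
    proof -
      have "e\<^sup>2 / 4 > 0" using that by simp
      then obtain n where n: "1 / real (Suc n) < e\<^sup>2 / 4"
        by (rule nat_approx_posE)
      have "dist x y < e" if "x \<in> S n" "y \<in> S n" for x y
      proof -
        have xy: "g x \<le> m + 1 / real (Suc n)" "g y \<le> m + 1 / real (Suc n)"
          using that unfolding S_def by blast+
        \<comment> \<open>parallelogram law: the linear part of the energy cancels\<close>
        define w where "w = (1 / 2) *\<^sub>R (x + y)"
        have "4 * g w = x \<bullet> x + 2 * (x \<bullet> y) + y \<bullet> y
            - 4 * blinfun_apply \<phi> x - 4 * blinfun_apply \<phi> y"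
          by (simp add: g_def w_def blinfun.add_right blinfun.scaleR_right inner_add_left
              inner_add_right inner_commute[of y x] add_divide_distrib)
        moreover have "(norm (x - y))\<^sup>2 = x \<bullet> x - 2 * (x \<bullet> y) + y \<bullet> y"
          by (simp add: power2_norm_eq_inner inner_diff_left inner_diff_right inner_commute[of y x])
        ultimately have "(norm (x - y))\<^sup>2 = 2 * g x + 2 * g y - 4 * g w"
          using g_def[of x] g_def[of y] by linarith
        then have "(norm (x - y))\<^sup>2 < e\<^sup>2"
          using xy n m[of w] by linarith
        then show ?thesis
          unfolding dist_norm using \<open>e > 0\<close> by (simp add: power2_less_imp_less)
      qed
      then show ?thesis by blast
    qed
  qed blast
  have "g a \<le> m"
  proof (rule field_le_epsilon)
    fix e :: real assume "e > 0"
    then obtain n where "1 / real (Suc n) < e"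
      by (rule nat_approx_posE)
    then show "g a \<le> m + e" using a[of n] by (simp add: S_def)
  qed
  then have min: "g a \<le> g x" for x using m[of x] by linarith
  have "blinfun_apply \<phi> x = a \<bullet> x" for x
  proof -
    define d where "d = a \<bullet> x - blinfun_apply \<phi> x"
    define N where "N = x \<bullet> x"
    \<comment> \<open>up to the summand 1, which covers \<open>x = 0\<close>, \<open>- t\<close> minimizes the energy along \<open>x\<close>\<close>
    define t where "t = d / (N + 1)"
    have N: "N \<ge> 0" by (simp add: N_def)
    then have d: "d = t * (N + 1)" by (simp add: t_def)
    have "g (a + (- t) *\<^sub>R x) = g a - 2 * t * d + t\<^sup>2 * N"
      by (simp add: g_def d_def N_def blinfun.diff_right blinfun.scaleR_right
          inner_diff_left inner_diff_right inner_commute[of x a] power2_eq_square algebra_simps)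
    then have "0 \<le> - (t\<^sup>2 * (N + 2))"
      using min[of "a + (- t) *\<^sub>R x"] unfolding d by (simp add: power2_eq_square algebra_simps)
    moreover have "t\<^sup>2 * (N + 2) \<ge> 0" using N by simp
    ultimately have "t\<^sup>2 * (N + 2) = 0" by linarith
    then have "d = 0" using N by (simp add: d)
    then show ?thesis by (simp add: d_def)
  qed
  then show thesis using that by blast
qed

text \<open>
  A functional on the dual becomes one on the space itself through \<open>a \<mapsto> (a \<bullet> _)\<close>, which
  reaches every element of the dual. Its representing vector is the point of evaluation.
\<close>

lemma hilbert_space_reflexive:
  fixes \<Phi> :: "('a::{real_inner, complete_space} \<Rightarrow>\<^sub>L real) \<Rightarrow> real"
  assumes "bounded_linear \<Phi>"
  obtains p where "\<And>q. \<Phi> q = blinfun_apply q p"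
proof -
  have "bounded_linear (\<lambda>a. \<Phi> (blinfun_inner_right a))"
    using assms bounded_linear_blinfun_inner_right by (rule bounded_linear_compose)
  then obtain p where p: "\<Phi> (blinfun_inner_right a) = p \<bullet> a" for a
    using riesz_representation[of "Blinfun (\<lambda>a. \<Phi> (blinfun_inner_right a))"]
    by (auto simp: bounded_linear_Blinfun_apply)
  have "\<Phi> q = blinfun_apply q p" for q
  proof -
    obtain a where a: "\<And>x. blinfun_apply q x = a \<bullet> x"
      using riesz_representation by blast
    then have "q = blinfun_inner_right a"
      by (intro blinfun_eqI) simp
    then show ?thesis using p a by (simp add: inner_commute)
  qed
  then show thesis using that by blast
qed

lemma dual_adjoint_apply:
  "blinfun_apply (dual_adjoint K p) h = blinfun_apply (blinfun_apply K h) p"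
  by (simp add: dual_adjoint_def)

text \<open>The functional \<open>b \<circ> A\<^sup>-\<^sup>1\<close> on the dual space is evaluation at some \<open>p\<close> by reflexivity.\<close>

lemma adjoint_equation_solvable:
  fixes A :: "'y::{real_inner, complete_space} \<Rightarrow>\<^sub>L ('y \<Rightarrow>\<^sub>L real)"
  assumes A: "bij (blinfun_apply A)" "bounded_linear (inv (blinfun_apply A))"
  obtains p where "dual_adjoint A p = b"
proof -
  have "bounded_linear (\<lambda>q. blinfun_apply b (inv (blinfun_apply A) q))"
    using blinfun.bounded_linear_right A(2) by (rule bounded_linear_compose)
  then obtain p where "blinfun_apply b (inv (blinfun_apply A) q) = blinfun_apply q p" for q
    using hilbert_space_reflexive by blast
  then have "blinfun_apply b h = blinfun_apply (blinfun_apply A h) p" for h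
    using A(1) by (metis bij_is_inj inv_f_f)
  then have "dual_adjoint A p = b"
    by (intro blinfun_eqI) (simp add: dual_adjoint_apply)
  then show thesis using that by blast
qed

section \<open>Interpolation on a full-dimensional simplex\<close>

text \<open>
  The edge vectors of the simplex at one fixed vertex form a basis, so a linear form can be
  prescribed on them and is determined by its values there.
\<close>

lemma affine_interpolant_affine:
  fixes T :: "(real ^ 'n) set"
  assumes T: "int CARD('n) simplex T"
  obtains a c where "affine_interpolant \<phi> T = (\<lambda>x. a \<bullet> x + c)"
proof -
  obtain V where V: "\<not> affine_dependent V" "int (card V) = int CARD('n) + 1" "T = convex hull V"
    using T by (auto simp: simplex_def)
  have ext: "v extreme_point_of T \<longleftrightarrow> v \<in> V" for v
    using V extreme_point_of_convex_hull_affine_independent by blast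
  have fin: "finite V" using V(1) aff_independent_finite by blast
  have "V \<noteq> {}" using V(2) by auto
  then obtain v0 where v0: "v0 \<in> V" by blast
  define E where "E = (\<lambda>v. - v0 + v) ` (V - {v0})"
  have indep: "independent E"
    using V(1) affine_dependent_iff_dependent2[OF v0] by (simp add: E_def)
  have "card E = CARD('n)"
    using V(2) fin v0 by (simp add: E_def card_image)
  then have span: "span E = UNIV"
    using card_ge_dim_independent[of E UNIV] indep by (auto simp: dim_UNIV)
  obtain L :: "real ^ 'n \<Rightarrow> real"
    where L: "linear L" "\<And>e. e \<in> E \<Longrightarrow> L e = \<phi> (v0 + e) - \<phi> v0"
    using linear_independent_extend[OF indep, of "\<lambda>e. \<phi> (v0 + e) - \<phi> v0"] by blast
  define a where "a = adjoint L 1"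
  have La: "L x = a \<bullet> x" for x
    using adjoint_works[OF L(1), of x 1] by (simp add: a_def inner_commute)
  define c where "c = \<phi> v0 - a \<bullet> v0"
  have interp: "a \<bullet> v + c = \<phi> v" if "v \<in> V" for v
  proof (cases "v = v0")
    case False
    then have "- v0 + v \<in> E" using that by (auto simp: E_def)
    from L(2)[OF this] show ?thesis
      by (simp add: La c_def inner_diff_right)
  qed (simp add: c_def)
  have "affine_interpolant \<phi> T = (\<lambda>x. a \<bullet> x + c)"
    unfolding affine_interpolant_def ext
  proof (rule the_equality)
    show "(\<exists>a' c'. \<forall>x. a \<bullet> x + c = a' \<bullet> x + c') \<and> (\<forall>v. v \<in> V \<longrightarrow> a \<bullet> v + c = \<phi> v)"
      using interp by blast
    fix g assume g: "(\<exists>a c. \<forall>x. g x = a \<bullet> x + c) \<and> (\<forall>v. v \<in> V \<longrightarrow> g v = \<phi> v)"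
    then obtain a' c' where g': "\<And>x. g x = a' \<bullet> x + c'" by blast
    have "a' \<bullet> e = a \<bullet> e" if "e \<in> E" for e
    proof -
      obtain v where "v \<in> V" "e = - v0 + v" using \<open>e \<in> E\<close> unfolding E_def by blast
      moreover have "g v = a \<bullet> v + c" "g v0 = a \<bullet> v0 + c"
        using g interp v0 \<open>v \<in> V\<close> by auto
      ultimately show ?thesis using g' by (simp add: inner_simps)
    qed
    then have "a' \<bullet> x = a \<bullet> x" for x
      using linear_eq_on[of "(\<bullet>) a'" "(\<bullet>) a" x E] span
      by (simp add: bounded_linear.linear bounded_linear_inner_right)
    moreover have "c' = c"
      using g g'[of v0] interp[OF v0] v0 calculation[of v0] by auto
    ultimately show "g = (\<lambda>x. a \<bullet> x + c)" using g' by auto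
  qed
  then show thesis using that by blast
qed

section \<open>The optimality system of the penalized problem\<close>

text \<open>
  The derivative of the penalized objective is nonnegative in all directions into the convex
  feasible set. The three relations come from testing with a varying parameter, from the choice
  of \<open>p\<close>, and from testing with a varying control.
\<close>

lemma penalized_minimizer_optimality_system:
  fixes Q T :: "(real ^ 'n) set"
    and Uad :: "'u::{real_inner, complete_space} set"
    and A :: "'y::{real_inner, complete_space} \<Rightarrow>\<^sub>L ('y \<Rightarrow>\<^sub>L real)"
  assumes setting: "inverse_control_setting Q Uad A B F f"
    and T: "convex T" "T \<subseteq> Q"
    and \<xi>: "\<xi> = (\<lambda>x. a \<bullet> x + c)"
    and min: "OVRP_solution Uad A B F f \<xi> T \<gamma> (\<beta>, y, u)"
  shows "\<exists>p. \<exists>\<zeta>\<in>normal_cone T \<beta>. \<exists>\<nu>\<in>normal_cone Uad u.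
        deriv_beta Q F \<beta> y u + \<gamma> *\<^sub>R (deriv_beta Q f \<beta> y u - fderiv \<xi> UNIV \<beta>) + \<zeta> = 0 \<and>
        deriv_y F \<beta> y u + \<gamma> *\<^sub>R deriv_y f \<beta> y u + dual_adjoint A p = 0 \<and>
        deriv_u F \<beta> y u + \<gamma> *\<^sub>R deriv_u f \<beta> y u - dual_adjoint B p + \<nu> = 0"
proof -
  interpret inverse_control_setting Q Uad A B F f by (rule setting)
  define C where "C = {(b, z, v). b \<in> T \<and> blinfun_apply A z = blinfun_apply B v \<and> v \<in> Uad}"
  define J where "J w = F w + \<gamma> * (f w - \<xi> (fst w))" for w
  have x: "(\<beta>, y, u) \<in> C" and Jmin: "\<And>w. w \<in> C \<Longrightarrow> J (\<beta>, y, u) \<le> J w"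
    using min by (auto simp: OVRP_solution_def is_arg_min_def C_def J_def not_less)
  have C: "convex C" "C \<subseteq> Q \<times> UNIV \<times> UNIV"
    using T Uad(3) unfolding convex_def
    by (auto simp: C_def blinfun.add_right blinfun.scaleR_right)
  have Q': "convex Q" "interior Q \<noteq> {}" "\<beta> \<in> Q"
    using Q polyhedron_imp_convex C(2) x by auto
  define r where "r = deriv_beta Q F \<beta> y u + \<gamma> *\<^sub>R (deriv_beta Q f \<beta> y u - fderiv \<xi> UNIV \<beta>)"
  define s where "s = deriv_y F \<beta> y u + \<gamma> *\<^sub>R deriv_y f \<beta> y u"
  define q where "q = deriv_u F \<beta> y u + \<gamma> *\<^sub>R deriv_u f \<beta> y u"
  have \<xi>': "(\<xi> has_derivative (\<bullet>) a) (at b within X)" for b X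
    unfolding \<xi> by (auto intro!: derivative_eq_intros)
  have fderiv_\<xi>: "blinfun_apply (fderiv \<xi> UNIV \<beta>) = (\<bullet>) a"
    by (rule fderiv_apply[OF \<xi>']) auto
  let ?DJ = "\<lambda>(h, k, l). blinfun_apply r h + blinfun_apply s k + blinfun_apply q l"
  have DF: "(F has_derivative (\<lambda>(h, k, l). blinfun_apply (deriv_beta Q F \<beta> y u) h
      + blinfun_apply (deriv_y F \<beta> y u) k + blinfun_apply (deriv_u F \<beta> y u) l))
      (at (\<beta>, y, u) within C)"
    using F(3) Q' C(2) unfolding continuously_differentiable_on_def
    by (blast intro: has_derivative_subset has_derivative_sum_of_partials)
  have Df: "(f has_derivative (\<lambda>(h, k, l). blinfun_apply (deriv_beta Q f \<beta> y u) h
      + blinfun_apply (deriv_y f \<beta> y u) k + blinfun_apply (deriv_u f \<beta> y u) l))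
      (at (\<beta>, y, u) within C)"
    using f(3) Q' C(2) unfolding continuously_differentiable_on_def
    by (blast intro: has_derivative_subset has_derivative_sum_of_partials)
  have D\<xi>: "((\<lambda>w. \<xi> (fst w)) has_derivative (\<lambda>w. a \<bullet> fst w)) (at (\<beta>, y, u) within C)"
    by (rule has_derivative_in_compose[OF has_derivative_fst[OF has_derivative_ident] \<xi>'])
  have DJ: "(J has_derivative ?DJ) (at (\<beta>, y, u) within C)"
    unfolding J_def
    by (rule has_derivative_eq_rhs[OF has_derivative_add[OF DF
            has_derivative_mult_right[OF has_derivative_diff[OF Df D\<xi>]]]])
      (auto simp: r_def s_def q_def fderiv_\<xi> blinfun.add_left blinfun.diff_left
        blinfun.scaleR_left algebra_simps)
  have VI: "blinfun_apply r (b - \<beta>) + blinfun_apply s (z - y) + blinfun_apply q (v - u) \<ge> 0"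
    if "(b, z, v) \<in> C" for b z v
    using minimizer_variational_inequality[OF DJ C(1) x that] Jmin by simp
  obtain p where p: "dual_adjoint A p = - s"
    using adjoint_equation_solvable[OF A_iso] by blast
  have "- r \<in> normal_cone T \<beta>"
    using VI[of _ y u] x
    by (auto simp: normal_cone_def C_def blinfun.minus_left)
  moreover have "dual_adjoint B p - q \<in> normal_cone Uad u"
  proof -
    have "blinfun_apply (dual_adjoint B p) (v - u) \<le> blinfun_apply q (v - u)" if v: "v \<in> Uad" for v
    proof -
      \<comment> \<open>the control \<open>v\<close> is tested together with its own state, so that the pair is feasible\<close>
      obtain z where z: "blinfun_apply A z = blinfun_apply B v"
        using A_iso(1) by (metis bij_pointE)
      have "blinfun_apply s (z - y) = - blinfun_apply (blinfun_apply A (z - y)) p"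
        using arg_cong[OF p, of "\<lambda>D. blinfun_apply D (z - y)"]
        by (simp add: dual_adjoint_apply blinfun.minus_left)
      also have "blinfun_apply A (z - y) = blinfun_apply B (v - u)"
        using z x by (simp add: C_def blinfun.diff_right)
      finally show ?thesis
        using VI[of \<beta> z v] x v z by (simp add: C_def dual_adjoint_apply)
    qed
    then show ?thesis
      using x by (auto simp: normal_cone_def C_def blinfun.diff_left)
  qed
  moreover have "r + - r = 0" "s + dual_adjoint A p = 0"
    "q - dual_adjoint B p + (dual_adjoint B p - q) = 0"
    by (simp_all add: p)
  ultimately show ?thesis
    unfolding r_def s_def q_def by blast
qed

text \<open>
  On the feasible set of the constrained problem the penalty term is nonpositive, and at the
  given point it vanishes, so the penalized objective lies below \<open>F\<close> and touches it there.
\<close>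

lemma penalized_minimizer_solves_constrained:
  assumes min: "OVRP_solution Uad A B F f \<xi> T \<gamma> (\<beta>, y, u)"
    and "\<gamma> \<ge> 0" "f (\<beta>, y, u) \<le> \<xi> \<beta>" "\<gamma> * (f (\<beta>, y, u) - \<xi> \<beta>) = 0"
  shows "OVR_solution Uad A B F f \<xi> T (\<beta>, y, u)"
proof -
  have feas: "OVR_feasible Uad A B f \<xi> T (\<beta>, y, u)"
    using min assms(3) by (auto simp: OVRP_solution_def is_arg_min_def OVR_feasible_def)
  have "F (\<beta>, y, u) \<le> F (b, z, v)" if z: "OVR_feasible Uad A B f \<xi> T (b, z, v)" for b z v
  proof -
    have "F (\<beta>, y, u) \<le> F (b, z, v) + \<gamma> * (f (b, z, v) - \<xi> b)"
      using min z assms(4)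
      by (auto simp: OVRP_solution_def is_arg_min_def OVR_feasible_def not_less)
    moreover have "\<gamma> * (f (b, z, v) - \<xi> b) \<le> 0"
      using z assms(2) by (auto simp: OVR_feasible_def mult_nonneg_nonpos)
    ultimately show ?thesis by linarith
  qed
  then show ?thesis
    using feas by (auto simp: OVR_solution_def is_arg_min_def not_less)
qed

theorem lemma4p7:
  fixes Q T :: "(real ^ 'n) set"
    and Uad :: "'u::{real_inner, complete_space} set"
    and A :: "'y::{real_inner, complete_space} \<Rightarrow>\<^sub>L ('y \<Rightarrow>\<^sub>L real)"
    and B :: "'u \<Rightarrow>\<^sub>L ('y \<Rightarrow>\<^sub>L real)"
    and F f :: "(real ^ 'n) \<times> 'y \<times> 'u \<Rightarrow> real"
    and \<mu>\<^sub>\<beta> \<gamma>\<^sub>T :: real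
    and \<phi> \<xi>\<^sub>T :: "real ^ 'n \<Rightarrow> real"
    and \<beta> :: "real ^ 'n" and y :: 'y and u :: 'u
  defines "\<phi> \<equiv> value_fun Uad A B f"
    and "\<xi>\<^sub>T \<equiv> affine_interpolant \<phi> T"
  assumes "inverse_control_setting Q Uad A B F f"
    and "\<mu>\<^sub>\<beta> > 0"
    and "\<forall>v\<in>Uad. strongly_convex_on Q \<mu>\<^sub>\<beta> (\<lambda>b. F (b, solution_op A B v, v))"
    and "int CARD('n) simplex T" and "T \<subseteq> Q"
    and "\<exists>b\<in>T. \<phi> b < \<xi>\<^sub>T b"
    and "(\<gamma>\<^sub>T = 0 \<and> OVRP_solution Uad A B F f \<xi>\<^sub>T T 0 (\<beta>, y, u) \<and> f (\<beta>, y, u) \<le> \<xi>\<^sub>T \<beta>) \<or>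
         (\<gamma>\<^sub>T > 0 \<and> OVRP_solution Uad A B F f \<xi>\<^sub>T T \<gamma>\<^sub>T (\<beta>, y, u) \<and> f (\<beta>, y, u) = \<xi>\<^sub>T \<beta>)"
  shows "OVR_solution Uad A B F f \<xi>\<^sub>T T (\<beta>, y, u) \<and>
         OVR_multiplier Q Uad A B F f \<xi>\<^sub>T T (\<beta>, y, u) \<gamma>\<^sub>T"
proof -
  have min: "OVRP_solution Uad A B F f \<xi>\<^sub>T T \<gamma>\<^sub>T (\<beta>, y, u)"
    and sign: "\<gamma>\<^sub>T \<ge> 0" "f (\<beta>, y, u) \<le> \<xi>\<^sub>T \<beta>" "\<gamma>\<^sub>T * (f (\<beta>, y, u) - \<xi>\<^sub>T \<beta>) = 0"
    using assms(9) by auto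
  obtain a c where \<xi>: "\<xi>\<^sub>T = (\<lambda>x. a \<bullet> x + c)"
    using affine_interpolant_affine[OF assms(6)] unfolding \<xi>\<^sub>T_def by blast
  have "convex T" using assms(6) by (auto simp: simplex_def)
  note kkt = penalized_minimizer_optimality_system[OF assms(3) this assms(7) \<xi> min]
  have sol: "OVR_solution Uad A B F f \<xi>\<^sub>T T (\<beta>, y, u)"
    using min sign by (rule penalized_minimizer_solves_constrained)
  then have "OVR_feasible Uad A B f \<xi>\<^sub>T T (\<beta>, y, u)"
    by (simp add: OVR_solution_def is_arg_min_def)
  then show ?thesis
    using sol sign kkt by (simp add: OVR_multiplier_def)
qed

end
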